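(* Let $T$ be a first-order theory and $\phi$ a sentence such that the theory $T+\neg\phi$ is undecidable. Then there is no effective procedure which, given a proof in $T+\phi$ of some statement $\psi$, decides whether $\psi$ is provable in $T$.
   Context: For a theory $T$ and a sentence $\alpha$, $T+\alpha$ denotes the theory obtained by adding $\alpha$ as an axiom to $T$. A theory is decidable if the set of its theorems is decidable (recursive), and undecidable otherwise.
   Formalization: The language is assumed to be effectively given (recursive sets of function and relation symbols); without this the claim fails, e.g. for an inconsistent T in a language whose set of symbols is not recursive. *)

theory Defs
  imports Main "HOL-Library.Nat_Bijection"
begin

section \<open>Partial recursive functions\<close>

text \<open>\<open>Zero\<close> and \<open>Proj i\<close> may be used at any arity; \<open>PrimRec\<close> and \<open>Mu\<close> recurse and search on the
  first argument.\<close>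

datatype recf =
    Zero
  | Succ
  | Proj nat
  | Comp recf "recf list"
  | PrimRec recf recf
  | Mu recf

text \<open>\<open>evals r xs y\<close>: the partial function denoted by \<open>r\<close> is defined at \<open>xs\<close>, with value \<open>y\<close>.\<close>

inductive evals :: "recf \<Rightarrow> nat list \<Rightarrow> nat \<Rightarrow> bool" where
  evals_Zero: "evals Zero xs 0"
| evals_Succ: "evals Succ [x] (Suc x)"
| evals_Proj: "i < length xs \<Longrightarrow> evals (Proj i) xs (xs ! i)"
| evals_Comp: "list_all2 (\<lambda>g y. evals g xs y) gs ys \<Longrightarrow> evals f ys z \<Longrightarrow> evals (Comp f gs) xs z"
| evals_PrimRec_0: "evals f xs z \<Longrightarrow> evals (PrimRec f g) (0 # xs) z"
| evals_PrimRec_Suc: "evals (PrimRec f g) (n # xs) y \<Longrightarrow> evals g (n # y # xs) z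
    \<Longrightarrow> evals (PrimRec f g) (Suc n # xs) z"
| evals_Mu: "evals f (n # xs) 0 \<Longrightarrow> (\<forall>m<n. \<exists>y>0. evals f (m # xs) y) \<Longrightarrow> evals (Mu f) xs n"

inductive_cases evals_ZeroE: "evals Zero xs y"
inductive_cases evals_SuccE: "evals Succ xs y"
inductive_cases evals_ProjE: "evals (Proj i) xs y"
inductive_cases evals_CompE: "evals (Comp f gs) xs y"
inductive_cases evals_PrimRec_0E: "evals (PrimRec f g) (0 # xs) y"
inductive_cases evals_PrimRec_SucE: "evals (PrimRec f g) (Suc n # xs) y"
inductive_cases evals_MuE: "evals (Mu f) xs y"

lemma evals_deterministic: "evals r xs y \<Longrightarrow> evals r xs z \<Longrightarrow> y = z"
proof (induction arbitrary: z rule: evals.induct)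
  case (evals_Zero xs)
  then show ?case by (rule evals_ZeroE) simp
next
  case (evals_Succ x)
  then show ?case by (rule evals_SuccE) simp
next
  case (evals_Proj i xs)
  from evals_Proj.prems show ?case by (rule evals_ProjE) simp
next
  case (evals_Comp xs gs ys f w)
  from evals_Comp.prems obtain ys' where
    ys': "list_all2 (\<lambda>g y. evals g xs y) gs ys'" and f: "evals f ys' z"
    by (rule evals_CompE)
  have "ys = ys'"
    using evals_Comp.IH(1) ys' by (auto simp: list_all2_conv_all_nth intro!: nth_equalityI)
  then show ?case using evals_Comp.IH(2) f by blast
next
  case (evals_PrimRec_0 f xs w g)
  from evals_PrimRec_0.prems show ?case
    by (rule evals_PrimRec_0E) (rule evals_PrimRec_0.IH)
next
  case (evals_PrimRec_Suc f g n xs y w)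
  from evals_PrimRec_Suc.prems obtain y' where
    "evals (PrimRec f g) (n # xs) y'" "evals g (n # y' # xs) z"
    by (rule evals_PrimRec_SucE)
  then show ?case using evals_PrimRec_Suc.IH by blast
next
  case (evals_Mu f n xs)
  from evals_Mu.prems have z: "evals f (z # xs) 0" "\<forall>m<z. \<exists>y>0. evals f (m # xs) y"
    by (rule evals_MuE, blast)+
  show ?case
  proof (rule linorder_cases[of n z])
    assume "n < z"
    then obtain y where "y > 0" "evals f (n # xs) y" using z(2) by blast
    then show ?thesis using evals_Mu.IH(1) by fastforce
  next
    assume "z < n"
    then obtain y where "y > 0" "\<forall>w. evals f (z # xs) w \<longrightarrow> y = w"
      using evals_Mu.IH(2) by blast
    then show ?thesis using z(1) by blast
  qed
qed

definition decidable :: "nat set \<Rightarrow> bool" where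
  "decidable A \<longleftrightarrow> (\<exists>r. \<forall>n. evals r [n] (if n \<in> A then 1 else 0))"


section \<open>First-order logic with equality\<close>

datatype tm = Var nat | Fun nat "tm list"

datatype fm =
    Eq tm tm
  | Rel nat "tm list"
  | Neg fm
  | Imp fm fm
  | All nat fm

text \<open>A language is given by its function and relation symbols, as (name, arity) pairs;
  constants are function symbols of arity 0.\<close>

record language =
  funs :: "(nat \<times> nat) set"
  rels :: "(nat \<times> nat) set"

fun wf_tm :: "language \<Rightarrow> tm \<Rightarrow> bool" where
  "wf_tm L (Var x) \<longleftrightarrow> True"
| "wf_tm L (Fun f ts) \<longleftrightarrow> (f, length ts) \<in> funs L \<and> (\<forall>t\<in>set ts. wf_tm L t)"

fun wf_fm :: "language \<Rightarrow> fm \<Rightarrow> bool" where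
  "wf_fm L (Eq s t) \<longleftrightarrow> wf_tm L s \<and> wf_tm L t"
| "wf_fm L (Rel p ts) \<longleftrightarrow> (p, length ts) \<in> rels L \<and> (\<forall>t\<in>set ts. wf_tm L t)"
| "wf_fm L (Neg A) \<longleftrightarrow> wf_fm L A"
| "wf_fm L (Imp A B) \<longleftrightarrow> wf_fm L A \<and> wf_fm L B"
| "wf_fm L (All x A) \<longleftrightarrow> wf_fm L A"

fun vars_tm :: "tm \<Rightarrow> nat set" where
  "vars_tm (Var x) = {x}"
| "vars_tm (Fun f ts) = (\<Union>t\<in>set ts. vars_tm t)"

fun free_vars :: "fm \<Rightarrow> nat set" where
  "free_vars (Eq s t) = vars_tm s \<union> vars_tm t"
| "free_vars (Rel p ts) = (\<Union>t\<in>set ts. vars_tm t)"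
| "free_vars (Neg A) = free_vars A"
| "free_vars (Imp A B) = free_vars A \<union> free_vars B"
| "free_vars (All x A) = free_vars A - {x}"

definition sentences :: "language \<Rightarrow> fm set" where
  "sentences L = {A. wf_fm L A \<and> free_vars A = {}}"

fun subst_tm :: "nat \<Rightarrow> tm \<Rightarrow> tm \<Rightarrow> tm" where
  "subst_tm x t (Var y) = (if y = x then t else Var y)"
| "subst_tm x t (Fun f ts) = Fun f (map (subst_tm x t) ts)"

text \<open>\<open>subst x t A\<close> replaces the free occurrences of \<open>x\<close> in \<open>A\<close> by \<open>t\<close> without renaming bound
  variables; it is only used together with \<open>free_for t x A\<close>, which excludes capture.\<close>

fun subst :: "nat \<Rightarrow> tm \<Rightarrow> fm \<Rightarrow> fm" where
  "subst x t (Eq u v) = Eq (subst_tm x t u) (subst_tm x t v)"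
| "subst x t (Rel p ts) = Rel p (map (subst_tm x t) ts)"
| "subst x t (Neg A) = Neg (subst x t A)"
| "subst x t (Imp A B) = Imp (subst x t A) (subst x t B)"
| "subst x t (All y A) = (if y = x then All y A else All y (subst x t A))"

fun free_for :: "tm \<Rightarrow> nat \<Rightarrow> fm \<Rightarrow> bool" where
  "free_for t x (Eq u v) \<longleftrightarrow> True"
| "free_for t x (Rel p ts) \<longleftrightarrow> True"
| "free_for t x (Neg A) \<longleftrightarrow> free_for t x A"
| "free_for t x (Imp A B) \<longleftrightarrow> free_for t x A \<and> free_for t x B"
| "free_for t x (All y A) \<longleftrightarrow> x \<notin> free_vars (All y A) \<or> (y \<notin> vars_tm t \<and> free_for t x A)"


section \<open>Proofs and theories\<close>

text \<open>A Hilbert calculus in the style of Mendelson, with modus ponens and generalization as rules.\<close>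

inductive logical_axiom :: "fm \<Rightarrow> bool" where
  ax_K: "logical_axiom (Imp A (Imp B A))"
| ax_S: "logical_axiom (Imp (Imp A (Imp B C)) (Imp (Imp A B) (Imp A C)))"
| ax_contra: "logical_axiom (Imp (Imp (Neg A) (Neg B)) (Imp (Imp (Neg A) B) A))"
| ax_inst: "free_for t x A \<Longrightarrow> logical_axiom (Imp (All x A) (subst x t A))"
| ax_all: "x \<notin> free_vars A \<Longrightarrow> logical_axiom (Imp (All x (Imp A B)) (Imp A (All x B)))"
| ax_refl: "logical_axiom (Eq t t)"
| ax_Leibniz: "free_for s x A \<Longrightarrow> free_for t x A
    \<Longrightarrow> logical_axiom (Imp (Eq s t) (Imp (subst x s A) (subst x t A)))"

definition is_proof :: "language \<Rightarrow> fm set \<Rightarrow> fm list \<Rightarrow> bool" where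
  "is_proof L T P \<longleftrightarrow> (\<forall>i<length P. wf_fm L (P ! i) \<and>
     (P ! i \<in> T \<or> logical_axiom (P ! i)
      \<or> (\<exists>j<i. \<exists>k<i. P ! k = Imp (P ! j) (P ! i))
      \<or> (\<exists>j<i. \<exists>x. P ! i = All x (P ! j))))"

definition is_proof_of :: "language \<Rightarrow> fm set \<Rightarrow> fm list \<Rightarrow> fm \<Rightarrow> bool" where
  "is_proof_of L T P A \<longleftrightarrow> is_proof L T P \<and> P \<noteq> [] \<and> last P = A"

definition provable :: "language \<Rightarrow> fm set \<Rightarrow> fm \<Rightarrow> bool" where
  "provable L T A \<longleftrightarrow> (\<exists>P. is_proof_of L T P A)"

text \<open>A theory is given by an arbitrary, not necessarily recursively enumerable, set of axioms.\<close>

definition is_theory :: "language \<Rightarrow> fm set \<Rightarrow> bool" where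
  "is_theory L T \<longleftrightarrow> T \<subseteq> sentences L"

definition add_axiom :: "fm set \<Rightarrow> fm \<Rightarrow> fm set" where
  "add_axiom T A = insert A T"

definition theorems :: "language \<Rightarrow> fm set \<Rightarrow> fm set" where
  "theorems L T = {A \<in> sentences L. provable L T A}"


section \<open>Goedel numbering and decidability of theories\<close>

fun code_tm :: "tm \<Rightarrow> nat" where
  "code_tm (Var x) = prod_encode (0, x)"
| "code_tm (Fun f ts) = prod_encode (1, prod_encode (f, list_encode (map code_tm ts)))"

fun code_fm :: "fm \<Rightarrow> nat" where
  "code_fm (Eq s t) = prod_encode (0, prod_encode (code_tm s, code_tm t))"
| "code_fm (Rel p ts) = prod_encode (1, prod_encode (p, list_encode (map code_tm ts)))"
| "code_fm (Neg A) = prod_encode (2, code_fm A)"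
| "code_fm (Imp A B) = prod_encode (3, prod_encode (code_fm A, code_fm B))"
| "code_fm (All x A) = prod_encode (4, prod_encode (x, code_fm A))"

definition code_proof :: "fm list \<Rightarrow> nat" where
  "code_proof P = list_encode (map code_fm P)"

lemma code_tm_inject: "code_tm s = code_tm t \<Longrightarrow> s = t"
proof (induction s arbitrary: t rule: code_tm.induct)
  case (1 x)
  then show ?case by (cases t) auto
next
  case (2 f ts)
  then obtain us where t: "t = Fun f us" and "map code_tm ts = map code_tm us"
    by (cases t) (auto simp: list_encode_eq)
  then have "ts = us"
    using 2(1) by (metis (no_types, lifting) length_map nth_equalityI nth_map nth_mem)
  then show ?case using t by simp
qed

lemma code_fm_inject: "code_fm A = code_fm B \<Longrightarrow> A = B"
proof (induction A arbitrary: B)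
  case (Rel p ts)
  have "inj code_tm" by (auto intro: injI code_tm_inject)
  with Rel show ?case by (cases B) (auto simp: list_encode_eq inj_map_eq_map)
next
  case (Eq s t)
  then show ?case by (cases B) (auto dest: code_tm_inject)
next
  case (Neg A)
  then show ?case by (cases B) auto
next
  case (Imp A1 A2)
  then show ?case by (cases B) auto
next
  case (All x A)
  then show ?case by (cases B) auto
qed

lemma code_proof_inject: "code_proof P = code_proof Q \<Longrightarrow> P = Q"
  by (metis code_proof_def code_fm_inject injI inj_map_eq_map list_encode_eq)

text \<open>Without effectiveness of the language not even the set of codes of sentences need be
  recursive.\<close>

definition effective_language :: "language \<Rightarrow> bool" where
  "effective_language L \<longleftrightarrow> decidable (prod_encode ` funs L) \<and> decidable (prod_encode ` rels L)"

definition decidable_theory :: "language \<Rightarrow> fm set \<Rightarrow> bool" where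
  "decidable_theory L T \<longleftrightarrow> decidable (code_fm ` theorems L T)"

text \<open>The procedure \<open>r\<close> receives (the code of) a proof, whose last line is the statement proved.
  Nothing is required of it, not even termination, on inputs that are not proofs of sentences
  in \<open>T'\<close>.\<close>

definition decides_provability_from_proofs ::
    "language \<Rightarrow> fm set \<Rightarrow> fm set \<Rightarrow> recf \<Rightarrow> bool" where
  "decides_provability_from_proofs L T' T r \<longleftrightarrow>
     (\<forall>P A. is_proof_of L T' P A \<and> A \<in> sentences L
        \<longrightarrow> evals r [code_proof P] (if provable L T A then 1 else 0))"

end

theory Submission
  imports Defs
begin

text \<open>By the deduction theorem, a sentence \<open>\<psi>\<close> is provable in \<open>T + \<not>\<phi>\<close> iff \<open>\<not>\<psi> \<longrightarrow> \<phi>\<close> is provable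
  in \<open>T\<close>. On the other hand \<open>T + \<phi>\<close> always proves \<open>\<not>\<psi> \<longrightarrow> \<phi>\<close>, by the three-line proof
  \<open>\<phi>\<close>, \<open>\<phi> \<longrightarrow> (\<not>\<psi> \<longrightarrow> \<phi>)\<close>, \<open>\<not>\<psi> \<longrightarrow> \<phi>\<close>, which is computable from \<open>\<psi>\<close>. Feeding it to a procedure
  that decides from such proofs whether the statement is provable in \<open>T\<close> would decide
  \<open>T + \<not>\<phi>\<close>. The set of sentences has to be decidable as well, since the procedure may diverge
  on other inputs.\<close>

section \<open>Total recursive functions\<close>

text \<open>A plain HOL function stands for the total function; only its values at lists of length
  \<open>k\<close> matter, so \<open>xs ! i\<close> with \<open>i < k\<close> is always
  meaningful.\<close>

definition recursive :: "nat \<Rightarrow> (nat list \<Rightarrow> nat) \<Rightarrow> bool" where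
  "recursive k f \<longleftrightarrow> (\<exists>r. \<forall>xs. length xs = k \<longrightarrow> evals r xs (f xs))"

abbreviation recursive_pred :: "nat \<Rightarrow> (nat list \<Rightarrow> bool) \<Rightarrow> bool" where
  "recursive_pred k P \<equiv> recursive k (\<lambda>xs. of_bool (P xs))"

named_theorems recursive_intros

lemma recursive_cong:
  assumes "recursive k f" "\<And>xs. length xs = k \<Longrightarrow> f xs = g xs"
  shows "recursive k g"
  using assms unfolding recursive_def by fastforce

lemma recursive_1_iff: "recursive 1 (\<lambda>xs. f (xs ! 0)) \<longleftrightarrow> (\<exists>r. \<forall>n. evals r [n] (f n))"
proof -
  have "(\<forall>xs. length xs = 1 \<longrightarrow> evals r xs (f (xs ! 0))) \<longleftrightarrow> (\<forall>n. evals r [n] (f n))" for r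
    by (auto simp: length_Suc_conv)
  then show ?thesis unfolding recursive_def by simp
qed

lemma decidable_iff_recursive_pred: "decidable A \<longleftrightarrow> recursive_pred 1 (\<lambda>xs. xs ! 0 \<in> A)"
  using recursive_1_iff[of "\<lambda>n. of_bool (n \<in> A)"] unfolding decidable_def of_bool_def by blast

lemma recursive_proj [recursive_intros]: "i < k \<Longrightarrow> recursive k (\<lambda>xs. xs ! i)"
  unfolding recursive_def by (metis evals_Proj)

lemma recursive_compose:
  assumes "recursive (length gs) f" "\<forall>g\<in>set gs. recursive k g"
  shows "recursive k (\<lambda>xs. f (map (\<lambda>g. g xs) gs))"
proof -
  obtain r where r: "\<And>xs. length xs = length gs \<Longrightarrow> evals r xs (f xs)"
    using assms(1) unfolding recursive_def by blast
  obtain s where s: "\<And>g xs. g \<in> set gs \<Longrightarrow> length xs = k \<Longrightarrow> evals (s g) xs (g xs)"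
    using assms(2) unfolding recursive_def by metis
  have "evals (Comp r (map s gs)) xs (f (map (\<lambda>g. g xs) gs))" if "length xs = k" for xs
    by (rule evals_Comp[OF _ r]) (auto simp: list_all2_conv_all_nth s that)
  then show ?thesis unfolding recursive_def by blast
qed

lemma recursive_compose1:
  "recursive 1 (\<lambda>xs. f (xs ! 0)) \<Longrightarrow> recursive k g \<Longrightarrow> recursive k (\<lambda>xs. f (g xs))"
  using recursive_compose[of "[g]" "\<lambda>xs. f (xs ! 0)" k] by simp

lemma recursive_compose2:
  "recursive 2 (\<lambda>xs. f (xs ! 0) (xs ! 1)) \<Longrightarrow> recursive k g \<Longrightarrow> recursive k h
    \<Longrightarrow> recursive k (\<lambda>xs. f (g xs) (h xs))"
  using recursive_compose[of "[g, h]" "\<lambda>xs. f (xs ! 0) (xs ! 1)" k] by (simp add: numeral_2_eq_2)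

lemma recursive_Suc [recursive_intros]: "recursive k f \<Longrightarrow> recursive k (\<lambda>xs. Suc (f xs))"
proof (erule recursive_compose1[of Suc, rotated])
  show "recursive 1 (\<lambda>xs. Suc (xs ! 0))"
    unfolding recursive_1_iff[of Suc] by (blast intro: evals_Succ)
qed

lemma recursive_const [recursive_intros]: "recursive k (\<lambda>_. c)"
proof (induction c)
  case 0
  show ?case unfolding recursive_def by (blast intro: evals_Zero)
qed (rule recursive_Suc)

text \<open>The step takes its arguments in the order \<open>n\<close>, \<open>y\<close>,
  \<open>p\<close> used by \<open>PrimRec\<close>. A single parameter suffices below; unary
  functions get a dummy one.\<close>

lemma recursive_primrec:
  assumes f: "recursive 1 (\<lambda>xs. f (xs ! 0))"
    and g: "recursive 3 (\<lambda>xs. g (xs ! 0) (xs ! 1) (xs ! 2))"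
    and F: "\<And>p. F 0 p = f p" "\<And>n p. F (Suc n) p = g n (F n p) p"
  shows "recursive 2 (\<lambda>xs. F (xs ! 0) (xs ! 1))"
proof -
  obtain r where r: "\<And>p. evals r [p] (f p)"
    using f unfolding recursive_1_iff[of f] by blast
  obtain s where s: "\<And>n y p. evals s [n, y, p] (g n y p)"
  proof -
    obtain s where s: "\<And>xs. length xs = 3 \<Longrightarrow> evals s xs (g (xs ! 0) (xs ! 1) (xs ! 2))"
      using g unfolding recursive_def by blast
    show thesis using that[of s] s[of "[_, _, _]"] by simp
  qed
  have ev: "evals (PrimRec r s) [n, p] (F n p)" for n p
    by (induction n) (auto simp: F intro: evals_PrimRec_0 evals_PrimRec_Suc r s)
  have "evals (PrimRec r s) xs (F (xs ! 0) (xs ! 1))" if "length xs = 2" for xs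
    using that ev by (auto simp: length_Suc_conv numeral_2_eq_2)
  then show ?thesis unfolding recursive_def by blast
qed

text \<open>\<open>Mu\<close> stops at the first zero, and a characteristic function is zero where
  its predicate fails; hence the search is for the least failure of \<open>P\<close>.\<close>

lemma recursive_mu:
  assumes P: "recursive 2 (\<lambda>xs. of_bool (P (xs ! 0) (xs ! 1)))"
    and total: "\<And>p. \<exists>n. \<not> P n p"
  shows "recursive 1 (\<lambda>xs. LEAST n. \<not> P n (xs ! 0))"
proof -
  obtain r where r: "\<And>n p. evals r [n, p] (of_bool (P n p))"
  proof -
    obtain r where r: "\<And>xs. length xs = 2 \<Longrightarrow> evals r xs (of_bool (P (xs ! 0) (xs ! 1)))"
      using P unfolding recursive_def by blast
    show thesis using that[of r] r[of "[_, _]"] by simp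
  qed
  have ev: "evals (Mu r) [p] (LEAST n. \<not> P n p)" for p
  proof (rule evals_Mu)
    have "\<not> P (LEAST n. \<not> P n p) p" using total by (rule LeastI_ex)
    then show "evals r [LEAST n. \<not> P n p, p] 0" using r by (metis of_bool_eq(1))
    show "\<forall>m<(LEAST n. \<not> P n p). \<exists>y>0. evals r [m, p] y"
      using r not_less_Least by (metis of_bool_eq(2) zero_less_one)
  qed
  then show ?thesis unfolding recursive_1_iff[of "\<lambda>p. LEAST n. \<not> P n p"] by blast
qed

section \<open>Arithmetic, Boolean connectives, case distinction and bounded quantification\<close>

lemma recursive_add [recursive_intros]:
  "recursive k f \<Longrightarrow> recursive k g \<Longrightarrow> recursive k (\<lambda>xs. f xs + g xs)"
  by (rule recursive_compose2[of "(+)"],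
      rule recursive_primrec[where f = "\<lambda>p. p" and g = "\<lambda>n y p. Suc y"])
    ((intro recursive_intros | simp)+)

lemma recursive_mult [recursive_intros]:
  "recursive k f \<Longrightarrow> recursive k g \<Longrightarrow> recursive k (\<lambda>xs. f xs * g xs)"
  by (rule recursive_compose2[of "(*)"],
      rule recursive_primrec[where f = "\<lambda>p. 0" and g = "\<lambda>n y p. p + y"])
    ((intro recursive_intros | simp)+)

lemma recursive_pred_nat:
  assumes "recursive k f"
  shows "recursive k (\<lambda>xs. f xs - 1)"
proof (rule recursive_compose2[of "\<lambda>n p. n - 1", OF _ assms assms])
  show "recursive 2 (\<lambda>xs. xs ! 0 - 1)"
    by (rule recursive_primrec[where f = "\<lambda>p. 0" and g = "\<lambda>n y p. n"]) ((intro recursive_intros | simp)+)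
qed

text \<open>Truncated subtraction iterates the predecessor. The recursion is on the subtrahend,
  which must come first; hence the swapped arguments.\<close>

lemma recursive_diff [recursive_intros]:
  assumes "recursive k f" "recursive k g"
  shows "recursive k (\<lambda>xs. f xs - g xs)"
proof (rule recursive_compose2[of "\<lambda>n p. p - n", OF _ assms(2,1)])
  show "recursive 2 (\<lambda>xs. xs ! 1 - xs ! 0)"
    by (rule recursive_primrec[where f = "\<lambda>p. p" and g = "\<lambda>n y p. y - 1"])
      ((intro recursive_intros recursive_pred_nat | simp)+)
qed

lemma recursive_pred_not [recursive_intros]:
  assumes "recursive_pred k P"
  shows "recursive_pred k (\<lambda>xs. \<not> P xs)"
  by (rule recursive_cong[of k "\<lambda>xs. 1 - of_bool (P xs)"]) ((intro recursive_intros assms | simp)+)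

lemma recursive_pred_conj [recursive_intros]:
  assumes "recursive_pred k P" "recursive_pred k Q"
  shows "recursive_pred k (\<lambda>xs. P xs \<and> Q xs)"
  by (rule recursive_cong[of k "\<lambda>xs. of_bool (P xs) * of_bool (Q xs)"])
    ((intro recursive_intros assms | simp)+)

lemma recursive_pred_disj [recursive_intros]:
  assumes "recursive_pred k P" "recursive_pred k Q"
  shows "recursive_pred k (\<lambda>xs. P xs \<or> Q xs)"
proof -
  have "recursive_pred k (\<lambda>xs. \<not> (\<not> P xs \<and> \<not> Q xs))"
    by (intro recursive_intros assms)
  then show ?thesis by simp
qed

text \<open>The truncated difference vanishes exactly when the inequality holds.\<close>

lemma recursive_pred_le [recursive_intros]:
  assumes "recursive k f" "recursive k g"
  shows "recursive_pred k (\<lambda>xs. f xs \<le> g xs)"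
  by (rule recursive_cong[of k "\<lambda>xs. 1 - (f xs - g xs)"]) ((intro recursive_intros assms | simp)+)

lemma recursive_pred_eq [recursive_intros]:
  assumes "recursive k f" "recursive k g"
  shows "recursive_pred k (\<lambda>xs. f xs = g xs)"
proof -
  have "recursive_pred k (\<lambda>xs. f xs \<le> g xs \<and> g xs \<le> f xs)"
    by (intro recursive_intros assms)
  then show ?thesis by (simp add: eq_iff)
qed

lemma recursive_If [recursive_intros]:
  assumes "recursive_pred k P" "recursive k f" "recursive k g"
  shows "recursive k (\<lambda>xs. if P xs then f xs else g xs)"
  by (rule recursive_cong[of k "\<lambda>xs. of_bool (P xs) * f xs + (1 - of_bool (P xs)) * g xs"])
    ((intro recursive_intros assms | simp)+)

lemma recursive_pred_If [recursive_intros]: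
  assumes "recursive_pred k P" "recursive_pred k Q" "recursive_pred k R"
  shows "recursive_pred k (\<lambda>xs. if P xs then Q xs else R xs)"
  by (rule recursive_cong[OF recursive_If[OF assms]]) auto

text \<open>By primitive recursion on the bound: the truth value is a running product over the
  instances.\<close>

lemma recursive_pred_all_le:
  assumes "recursive 2 (\<lambda>xs. of_bool (P (xs ! 0) (xs ! 1)))"
  shows "recursive 2 (\<lambda>xs. of_bool (\<forall>i\<le>xs ! 0. P i (xs ! 1)))"
proof (rule recursive_primrec[where f = "\<lambda>p. of_bool (P 0 p)"
      and g = "\<lambda>n y p. y * of_bool (P (Suc n) p)" and F = "\<lambda>n p. of_bool (\<forall>i\<le>n. P i p)"])
  show "recursive 1 (\<lambda>xs. of_bool (P 0 (xs ! 0)))"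
    by (rule recursive_compose2[OF assms]) ((intro recursive_intros | simp)+)
  have "recursive 3 (\<lambda>xs. of_bool (P (Suc (xs ! 0)) (xs ! 2)))"
    by (rule recursive_compose2[OF assms]) ((intro recursive_intros | simp)+)
  then show "recursive 3 (\<lambda>xs. xs ! 1 * of_bool (P (Suc (xs ! 0)) (xs ! 2)))"
    by ((intro recursive_intros | simp)+)
qed (auto simp: le_Suc_eq)

section \<open>Pairs and course-of-values recursion\<close>

abbreviation pfst :: "nat \<Rightarrow> nat" where "pfst n \<equiv> fst (prod_decode n)"
abbreviation psnd :: "nat \<Rightarrow> nat" where "psnd n \<equiv> snd (prod_decode n)"

lemma recursive_triangle [recursive_intros]:
  assumes "recursive k f"
  shows "recursive k (\<lambda>xs. triangle (f xs))"
proof (rule recursive_compose2[of "\<lambda>n p. triangle n", OF _ assms assms])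
  show "recursive 2 (\<lambda>xs. triangle (xs ! 0))"
    by (rule recursive_primrec[where f = "\<lambda>p. 0" and g = "\<lambda>n y p. y + Suc n"])
      ((intro recursive_intros | simp)+)
qed

lemma recursive_prod_encode [recursive_intros]:
  "recursive k f \<Longrightarrow> recursive k g \<Longrightarrow> recursive k (\<lambda>xs. prod_encode (f xs, g xs))"
  unfolding prod_encode_def by (simp, intro recursive_intros)

lemma triangle_mono: "m \<le> n \<Longrightarrow> triangle m \<le> triangle n"
  by (induction rule: dec_induct) auto

lemma le_triangle: "n \<le> triangle n"
  by (induction n) auto

lemma triangle_decode: "triangle (pfst n + psnd n) + pfst n = n"
  using prod_decode_inverse[of n] unfolding prod_encode_def by (simp add: case_prod_beta)

text \<open>\<open>prod_encode\<close> is Cantor's pairing: \<open>n\<close> lies on the diagonal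
  \<open>s = pfst n + psnd n\<close> at offset \<open>pfst n \<le> s\<close>, so
  \<open>triangle s \<le> n < triangle (Suc s)\<close>. This makes the diagonal computable by
  search.\<close>

lemma pfst_add_psnd: "pfst n + psnd n = (LEAST s. \<not> triangle (Suc s) \<le> n)"
proof (rule Least_equality[symmetric])
  obtain a b where n: "prod_decode n = (a, b)" by force
  then have eq: "n = triangle (a + b) + a"
    using triangle_decode[of n] by simp
  show "\<not> triangle (Suc (pfst n + psnd n)) \<le> n" using n eq by simp
  fix s assume s: "\<not> triangle (Suc s) \<le> n"
  show "pfst n + psnd n \<le> s"
  proof (rule ccontr)
    assume "\<not> ?thesis"
    then have "triangle (Suc s) \<le> triangle (a + b)" using n by (intro triangle_mono) simp
    then show False using s eq by simp
  qed
qed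

lemma recursive_pfst_psnd [recursive_intros]:
  assumes "recursive k f"
  shows "recursive k (\<lambda>xs. pfst (f xs))" "recursive k (\<lambda>xs. psnd (f xs))"
proof -
  have "recursive 1 (\<lambda>xs. LEAST s. \<not> triangle (Suc s) \<le> xs ! 0)"
  proof (rule recursive_mu)
    show "recursive 2 (\<lambda>xs. of_bool (triangle (Suc (xs ! 0)) \<le> xs ! 1))"
      by (intro recursive_intros) simp_all
    show "\<exists>n. \<not> triangle (Suc n) \<le> p" for p
      using le_triangle[of "Suc p"] by (intro exI[of _ p]) linarith
  qed
  then have s: "recursive k (\<lambda>xs. pfst (f xs) + psnd (f xs))"
    using recursive_compose1[of "\<lambda>n. LEAST s. \<not> triangle (Suc s) \<le> n", OF _ assms]
    unfolding pfst_add_psnd by blast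
  \<comment> \<open>The first component is the offset on the diagonal, and the second is what
    remains of the diagonal index.\<close>
  have eq: "pfst n = n - triangle (pfst n + psnd n)" for n
    using triangle_decode[of n] by simp
  have "recursive k (\<lambda>xs. f xs - triangle (pfst (f xs) + psnd (f xs)))"
    by (intro recursive_intros assms s)
  then show *: "recursive k (\<lambda>xs. pfst (f xs))" by (simp only: eq[symmetric])
  have "recursive k (\<lambda>xs. pfst (f xs) + psnd (f xs) - pfst (f xs))"
    by (intro recursive_intros * s)
  then show "recursive k (\<lambda>xs. psnd (f xs))" by simp
qed

lemma pfst_le: "pfst n \<le> n" and psnd_le: "psnd n \<le> n"
  using le_prod_encode_1[of "pfst n" "psnd n"] le_prod_encode_2[of "psnd n" "pfst n"] by simp_all

text \<open>Formula codes carry a tag in the first component. This strict descent under a positive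
  tag drives the recursions on formula codes.\<close>

lemma psnd_less: "pfst n > 0 \<Longrightarrow> psnd n < n"
proof -
  assume "pfst n > 0"
  then show ?thesis using triangle_decode[of n] le_triangle[of "pfst n + psnd n"] by linarith
qed

text \<open>This is the \<open>list_encode\<close> of \<open>F (n - 1), ..., F 0\<close>, newest
  value first.\<close>

fun history :: "(nat \<Rightarrow> nat) \<Rightarrow> nat \<Rightarrow> nat" where
  "history F 0 = 0"
| "history F (Suc n) = Suc (prod_encode (F n, history F n))"

fun drop_code :: "nat \<Rightarrow> nat \<Rightarrow> nat" where
  "drop_code 0 h = h"
| "drop_code (Suc i) h = psnd (drop_code i h - 1)"

text \<open>As the newest value comes first, \<open>F i\<close> sits at position
  \<open>n - Suc i\<close>; subtracting 1 undoes the \<open>Suc\<close> of a nonempty list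
  code.\<close>

definition recall :: "nat \<Rightarrow> nat \<Rightarrow> nat \<Rightarrow> nat" where
  "recall n h i = pfst (drop_code (n - Suc i) h - 1)"

lemma recursive_recall [recursive_intros]:
  assumes "recursive k f" "recursive k g" "recursive k h"
  shows "recursive k (\<lambda>xs. recall (f xs) (g xs) (h xs))"
proof -
  have "recursive 2 (\<lambda>xs. drop_code (xs ! 0) (xs ! 1))"
    by (rule recursive_primrec[where f = "\<lambda>p. p" and g = "\<lambda>n y p. psnd (y - 1)"])
      ((intro recursive_intros | simp)+)
  then have "recursive k (\<lambda>xs. drop_code (f xs - Suc (h xs)) (g xs))"
    by (rule recursive_compose2) (intro recursive_intros assms)+
  then show ?thesis unfolding recall_def by (intro recursive_intros)
qed

lemma drop_code_history: "i \<le> n \<Longrightarrow> drop_code i (history F n) = history F (n - i)"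
proof (induction i)
  case (Suc i)
  then obtain m where m: "n - i = Suc m" "n - Suc i = m" by (cases "n - i") auto
  show ?case using Suc by (simp add: m)
qed simp

lemma recall_history [simp]: "i < n \<Longrightarrow> recall n (history F n) i = F i"
proof -
  assume "i < n"
  then have "n - (n - Suc i) = Suc i" by simp
  then show ?thesis by (simp add: recall_def drop_code_history)
qed

text \<open>The next entry depends only on \<open>n\<close>, \<open>p\<close> and the history so
  far, so the history is obtained by primitive recursion; \<open>F n p\<close> is then the head of
  the history of length \<open>Suc n\<close>.\<close>

lemma recursive_course_of_values:
  assumes G: "recursive 3 (\<lambda>xs. G (xs ! 0) (xs ! 1) (xs ! 2))"
    and F: "\<And>n p. F n p = G n (history (\<lambda>i. F i p) n) p"
  shows "recursive 2 (\<lambda>xs. F (xs ! 0) (xs ! 1))"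
proof -
  have hist: "recursive 2 (\<lambda>xs. history (\<lambda>i. F i (xs ! 1)) (xs ! 0))"
    by (rule recursive_primrec[where f = "\<lambda>p. 0" and g = "\<lambda>n y p. Suc (prod_encode (G n y p, y))"
          and F = "\<lambda>n p. history (\<lambda>i. F i p) n"]) ((intro recursive_intros G | simp flip: F)+)
  have "recursive 2 (\<lambda>xs. pfst (history (\<lambda>i. F i (xs ! 1)) (Suc (xs ! 0)) - 1))"
    by (intro recursive_intros recursive_compose2[where f = "\<lambda>n p. history (\<lambda>i. F i p) n", OF hist]) auto
  then show ?thesis by simp
qed

section \<open>The deduction theorem\<close>

lemma is_proof_Nil [simp]: "is_proof L T []"
  by (simp add: is_proof_def)

text \<open>Replaces line indices by membership, so that proofs can be handled by induction on their
  last line.\<close>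

lemma is_proof_snoc:
  "is_proof L T (P @ [A]) \<longleftrightarrow> is_proof L T P \<and> wf_fm L A \<and>
     (A \<in> T \<or> logical_axiom A \<or> (\<exists>B. B \<in> set P \<and> Imp B A \<in> set P) \<or> (\<exists>x. \<exists>B\<in>set P. A = All x B))"
proof -
  have less_Suc: "(\<forall>i<Suc n. Q i) \<longleftrightarrow> (\<forall>i<n. Q i) \<and> Q n" for n and Q :: "nat \<Rightarrow> bool"
    by (auto simp: less_Suc_eq)
  have mp: "(\<exists>j<length P. \<exists>k<length P. P ! k = Imp (P ! j) A) \<longleftrightarrow> (\<exists>B. B \<in> set P \<and> Imp B A \<in> set P)"
    by (metis in_set_conv_nth)
  have gen: "(\<exists>j<length P. \<exists>x. A = All x (P ! j)) \<longleftrightarrow> (\<exists>x. \<exists>B\<in>set P. A = All x B)"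
    by (metis in_set_conv_nth)
  show ?thesis
    unfolding mp[symmetric] gen[symmetric] is_proof_def
    by (simp add: less_Suc nth_append cong: conj_cong)
qed

lemma is_proof_append: "is_proof L T P \<Longrightarrow> is_proof L T Q \<Longrightarrow> is_proof L T (P @ Q)"
proof (induction Q rule: rev_induct)
  case (snoc A Q)
  then have "is_proof L T ((P @ Q) @ [A])"
    unfolding is_proof_snoc by auto
  then show ?case by simp
qed simp

lemma provable_induct [consumes 1, case_names ax mp gen]:
  assumes "provable L T A"
    and ax: "\<And>A. A \<in> T \<or> logical_axiom A \<Longrightarrow> wf_fm L A \<Longrightarrow> Q A"
    and mp: "\<And>A B. wf_fm L (Imp A B) \<Longrightarrow> Q (Imp A B) \<Longrightarrow> Q A \<Longrightarrow> Q B"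
    and gen: "\<And>x A. wf_fm L A \<Longrightarrow> Q A \<Longrightarrow> Q (All x A)"
  shows "Q A"
proof -
  obtain P where P: "is_proof L T P" "P \<noteq> []" "last P = A"
    using assms(1) unfolding provable_def is_proof_of_def by blast
  \<comment> \<open>The claim is strengthened to all lines because the rules refer to earlier ones;
    well-formedness is carried along for the cases \<open>mp\<close> and \<open>gen\<close>.\<close>
  have "\<forall>B\<in>set P. wf_fm L B \<and> Q B"
    using P(1)
  proof (induction P rule: rev_induct)
    case (snoc B P)
    then have IH: "\<forall>B\<in>set P. wf_fm L B \<and> Q B" and B: "wf_fm L B"
      "(B \<in> T \<or> logical_axiom B) \<or> (\<exists>C. C \<in> set P \<and> Imp C B \<in> set P) \<or> (\<exists>x. \<exists>C\<in>set P. B = All x C)"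
      by (auto simp: is_proof_snoc)
    from B(2) have "Q B"
    proof (elim disjE)
      assume "\<exists>C. C \<in> set P \<and> Imp C B \<in> set P"
      then show ?thesis using IH mp by blast
    next
      assume "\<exists>x. \<exists>C\<in>set P. B = All x C"
      then show ?thesis using IH gen by blast
    qed (use ax B(1) in auto)
    then show ?case using IH B(1) by simp
  qed simp
  then show ?thesis using P by (metis last_in_set)
qed

lemma provable_wf: "provable L T A \<Longrightarrow> wf_fm L A"
  by (induction rule: provable_induct) auto

lemma provable_axiom: "A \<in> T \<or> logical_axiom A \<Longrightarrow> wf_fm L A \<Longrightarrow> provable L T A"
  unfolding provable_def is_proof_of_def is_proof_def by (intro exI[of _ "[A]"]) auto

lemma provable_mp:
  assumes "provable L T (Imp A B)" "provable L T A"
  shows "provable L T B"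
proof -
  obtain P Q where P: "is_proof_of L T P (Imp A B)" and Q: "is_proof_of L T Q A"
    using assms unfolding provable_def by blast
  then have "Imp A B \<in> set P" "A \<in> set Q" unfolding is_proof_of_def by (metis last_in_set)+
  then have "is_proof L T ((P @ Q) @ [B])"
    using P Q provable_wf[OF assms(1)]
    unfolding is_proof_snoc by (auto simp: is_proof_of_def intro: is_proof_append)
  then show ?thesis unfolding provable_def is_proof_of_def by fastforce
qed

lemma provable_gen:
  assumes "provable L T A"
  shows "provable L T (All x A)"
proof -
  obtain P where P: "is_proof_of L T P A" using assms unfolding provable_def by blast
  then have "A \<in> set P" unfolding is_proof_of_def by (metis last_in_set)
  then have "is_proof L T (P @ [All x A])"
    using P provable_wf[OF assms] by (auto simp: is_proof_of_def is_proof_snoc)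
  then show ?thesis unfolding provable_def is_proof_of_def by fastforce
qed

lemma provable_mono: "provable L T A \<Longrightarrow> T \<subseteq> U \<Longrightarrow> provable L U A"
  by (induction rule: provable_induct) (auto intro: provable_axiom provable_mp provable_gen)

text \<open>The usual derivation from one instance of \<open>ax_S\<close> and two of
  \<open>ax_K\<close>.\<close>

lemma provable_Imp_refl: "wf_fm L A \<Longrightarrow> provable L T (Imp A A)"
  by (rule provable_mp[OF provable_mp[OF provable_axiom[OF disjI2[OF ax_S[of A "Imp A A" A]]]]])
    (auto intro!: provable_axiom ax_K)

lemma provable_K: "wf_fm L B \<Longrightarrow> provable L T A \<Longrightarrow> provable L T (Imp B A)"
  by (rule provable_mp[OF provable_axiom[OF disjI2[OF ax_K]]]) (auto dest: provable_wf)

text \<open>Generalization is the critical case: \<open>A\<close> has no free variables, so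
  \<open>ax_all\<close> moves the quantifier past it. Modus ponens is handled by
  \<open>ax_S\<close>.\<close>

theorem deduction_theorem:
  assumes "provable L (insert A T) B" "A \<in> sentences L"
  shows "provable L T (Imp A B)"
proof -
  have A: "wf_fm L A" "free_vars A = {}" using assms(2) by (auto simp: sentences_def)
  show ?thesis
    using assms(1)
  proof (induction rule: provable_induct)
    case (ax B)
    then show ?case using A by (auto intro: provable_Imp_refl provable_K provable_axiom)
  next
    case (mp B C)
    have "provable L T (Imp (Imp A (Imp B C)) (Imp (Imp A B) (Imp A C)))"
      using mp A by (auto intro!: provable_axiom ax_S)
    then show ?case using mp by (blast intro: provable_mp)
  next
    case (gen x B)
    have "provable L T (Imp (All x (Imp A B)) (Imp A (All x B)))"
      using gen A by (auto intro!: provable_axiom ax_all)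
    then show ?case using gen by (blast intro: provable_mp provable_gen)
  qed
qed

lemma provable_by_contradiction:
  assumes "provable L T (Imp (Neg A) (Neg B))" "provable L T (Imp (Neg A) B)"
  shows "provable L T A"
  by (rule provable_mp[OF provable_mp[OF provable_axiom[OF disjI2[OF ax_contra]] assms(1)] assms(2)])
    (use assms[THEN provable_wf] in auto)

lemma provable_add_Neg_iff:
  assumes \<phi>: "\<phi> \<in> sentences L" and \<psi>: "\<psi> \<in> sentences L"
  shows "provable L (insert (Neg \<phi>) T) \<psi> \<longleftrightarrow> provable L T (Imp (Neg \<psi>) \<phi>)"
proof
  have wf: "wf_fm L \<phi>" "wf_fm L \<psi>" and Neg: "Neg \<phi> \<in> sentences L" "Neg \<psi> \<in> sentences L"
    using assms by (auto simp: sentences_def)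
  \<comment> \<open>With \<open>Neg \<psi>\<close> added to \<open>T\<close>,
    \<open>Neg \<phi>\<close> implies both \<open>Neg \<psi>\<close> and \<open>\<psi>\<close>,
    which yields \<open>\<phi>\<close>; then \<open>Neg \<psi>\<close> is discharged.\<close>
  show "provable L T (Imp (Neg \<psi>) \<phi>)" if "provable L (insert (Neg \<phi>) T) \<psi>"
  proof (rule deduction_theorem[OF provable_by_contradiction[of _ _ _ \<psi>] Neg(2)])
    show "provable L (insert (Neg \<psi>) T) (Imp (Neg \<phi>) (Neg \<psi>))"
      using wf by (intro provable_K provable_axiom) auto
    show "provable L (insert (Neg \<psi>) T) (Imp (Neg \<phi>) \<psi>)"
      using deduction_theorem[OF that Neg(1)] by (rule provable_mono) auto
  qed
  \<comment> \<open>Conversely, with \<open>Neg \<phi>\<close> added to \<open>T\<close>,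
    \<open>Neg \<psi>\<close> implies both \<open>Neg \<phi>\<close> and \<open>\<phi>\<close>,
    which yields \<open>\<psi>\<close>.\<close>
  show "provable L (insert (Neg \<phi>) T) \<psi>" if "provable L T (Imp (Neg \<psi>) \<phi>)"
  proof (rule provable_by_contradiction[of _ _ _ \<phi>])
    show "provable L (insert (Neg \<phi>) T) (Imp (Neg \<psi>) (Neg \<phi>))"
      using wf by (intro provable_K provable_axiom) auto
    show "provable L (insert (Neg \<phi>) T) (Imp (Neg \<psi>) \<phi>)"
      using that by (rule provable_mono) auto
  qed
qed

section \<open>Decidability of the set of sentences\<close>

text \<open>Works directly on codes, every natural number being the code of a list; it serves to
  check arities.\<close>

function length_code :: "nat \<Rightarrow> nat" where
  "length_code 0 = 0"
| "length_code (Suc m) = Suc (length_code (psnd m))"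
  by pat_completeness auto
termination
  by (relation "measure id") (auto simp: less_Suc_eq_le psnd_le)

lemma length_code_list_encode [simp]: "length_code (list_encode xs) = length xs"
  by (induction xs) auto

lemma recursive_length_code [recursive_intros]:
  assumes "recursive k f"
  shows "recursive k (\<lambda>xs. length_code (f xs))"
proof (rule recursive_compose2[of "\<lambda>n p. length_code n", OF _ assms assms])
  show "recursive 2 (\<lambda>xs. length_code (xs ! 0))"
  proof (rule recursive_course_of_values[
        where G = "\<lambda>n h p. if n = 0 then 0 else Suc (recall n h (psnd (n - 1)))"])
    show "recursive 3 (\<lambda>xs. if xs ! 0 = 0 then 0 else Suc (recall (xs ! 0) (xs ! 1) (psnd (xs ! 0 - 1))))"
      by (intro recursive_intros) simp_all
    show "length_code n = (if n = 0 then 0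
        else Suc (recall n (history (\<lambda>i. length_code i) n) (psnd (n - 1))))" for n
      by (cases n) (simp_all del: history.simps add: less_Suc_eq_le psnd_le)
  qed
qed

text \<open>The parameter \<open>x\<close> of \<open>terms_ok\<close> and \<open>fm_ok\<close> is \<open>0\<close> for checking that the argument is the
  code of a well-formed object, and \<open>Suc v\<close> for checking in addition that \<open>v\<close> is not free in it.
  Checking codes of lists of terms, with the check of the head unfolded, avoids a mutual recursion.
  Only \<open>fm_ok 0\<close> rejects all codes of ill-formed formulas.\<close>

function terms_ok :: "language \<Rightarrow> nat \<Rightarrow> nat \<Rightarrow> bool" where
  "terms_ok L x 0 \<longleftrightarrow> True"
| "terms_ok L x (Suc m) \<longleftrightarrow> terms_ok L x (psnd m) \<and>
     (if pfst (pfst m) = 0 then x \<noteq> Suc (psnd (pfst m))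
      else pfst (pfst m) = 1 \<and>
        prod_encode (pfst (psnd (pfst m)), length_code (psnd (psnd (pfst m)))) \<in> prod_encode ` funs L \<and>
        terms_ok L x (psnd (psnd (pfst m))))"
  by pat_completeness auto
termination
  by (relation "measure (\<lambda>(L, x, n). n)")
    (auto simp: less_Suc_eq_le psnd_le intro: order_trans[OF psnd_le] order_trans[OF psnd_le pfst_le])

function fm_ok :: "language \<Rightarrow> nat \<Rightarrow> nat \<Rightarrow> bool" where
  "fm_ok L x n \<longleftrightarrow>
     (if pfst n = 0 then terms_ok L x (list_encode [pfst (psnd n), psnd (psnd n)])
      else if pfst n = 1 then
        prod_encode (pfst (psnd n), length_code (psnd (psnd n))) \<in> prod_encode ` rels L \<and>
        terms_ok L x (psnd (psnd n))
      else if pfst n = 2 then fm_ok L x (psnd n)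
      else if pfst n = 3 then fm_ok L x (pfst (psnd n)) \<and> fm_ok L x (psnd (psnd n))
      else pfst n = 4 \<and> (x = Suc (pfst (psnd n)) \<or> fm_ok L x (psnd (psnd n))))"
  by pat_completeness auto
termination
  \<comment> \<open>Recursive calls occur only under a positive tag, so \<open>psnd_less\<close>
    applies; equations, with tag 0, are handed to \<open>terms_ok\<close>.\<close>
  by (relation "measure (\<lambda>(L, x, n). n)")
    (auto intro: psnd_less le_less_trans[OF psnd_le psnd_less] le_less_trans[OF pfst_le psnd_less])

declare terms_ok.simps(2) [simp del] fm_ok.simps [simp del]

section \<open>Recursiveness of the checkers\<close>

lemma recursive_pred_mem:
  assumes "decidable A" "recursive k f"
  shows "recursive_pred k (\<lambda>xs. f xs \<in> A)"
  using recursive_compose1[of "\<lambda>n. of_bool (n \<in> A)", OF _ assms(2)] assms(1)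
  unfolding decidable_iff_recursive_pred by blast

lemma recursive_terms_ok:
  assumes "decidable (prod_encode ` funs L)" "recursive k f" "recursive k g"
  shows "recursive_pred k (\<lambda>xs. terms_ok L (f xs) (g xs))"
proof (rule recursive_compose2[of "\<lambda>n x. of_bool (terms_ok L x n)", OF _ assms(3,2)])
  \<comment> \<open>\<open>?G\<close> is the body of \<open>terms_ok\<close> with the recursive
    calls replaced by lookups in the history, where truth is the value 1. The recursion is on the
    code \<open>n\<close>, with parameter \<open>x\<close>.\<close>
  let ?G = "\<lambda>n h x. of_bool (n = 0 \<or> recall n h (psnd (n - 1)) = 1 \<and>
     (if pfst (pfst (n - 1)) = 0 then \<not> x = Suc (psnd (pfst (n - 1)))
      else pfst (pfst (n - 1)) = 1 \<and>
        prod_encode (pfst (psnd (pfst (n - 1))), length_code (psnd (psnd (pfst (n - 1)))))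
          \<in> prod_encode ` funs L \<and>
        recall n h (psnd (psnd (pfst (n - 1)))) = 1)) :: nat"
  show "recursive 2 (\<lambda>xs. of_bool (terms_ok L (xs ! 1) (xs ! 0)))"
  proof (rule recursive_course_of_values[where G = ?G])
    show "recursive 3 (\<lambda>xs. ?G (xs ! 0) (xs ! 1) (xs ! 2))"
      by (intro recursive_intros recursive_pred_mem assms) simp_all
    show "of_bool (terms_ok L x n) = ?G n (history (\<lambda>i. of_bool (terms_ok L x i)) n) x" for n x
    proof (cases n)
      case (Suc m)
      have "psnd m < n" "psnd (psnd (pfst m)) < n"
        unfolding Suc less_Suc_eq_le by (meson psnd_le pfst_le order_trans)+
      then show ?thesis by (auto simp: Suc terms_ok.simps(2) simp del: history.simps)
    qed simp
  qed
qed

lemma recursive_fm_ok: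
  assumes "effective_language L" "recursive k f" "recursive k g"
  shows "recursive_pred k (\<lambda>xs. fm_ok L (f xs) (g xs))"
proof (rule recursive_compose2[of "\<lambda>n x. of_bool (fm_ok L x n)", OF _ assms(3,2)])
  have L: "decidable (prod_encode ` funs L)" "decidable (prod_encode ` rels L)"
    using assms(1) unfolding effective_language_def by auto
  \<comment> \<open>As for \<open>terms_ok\<close>; the list code of the two sides of an equation is
    written out in pairs so that the closure rules apply.\<close>
  let ?G = "\<lambda>n h x. of_bool
     (if pfst n = 0 then terms_ok L x (Suc (prod_encode (pfst (psnd n), Suc (prod_encode (psnd (psnd n), 0)))))
      else if pfst n = 1 then
        prod_encode (pfst (psnd n), length_code (psnd (psnd n))) \<in> prod_encode ` rels L \<and>
        terms_ok L x (psnd (psnd n))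
      else if pfst n = 2 then recall n h (psnd n) = 1
      else if pfst n = 3 then recall n h (pfst (psnd n)) = 1 \<and> recall n h (psnd (psnd n)) = 1
      else pfst n = 4 \<and> (x = Suc (pfst (psnd n)) \<or> recall n h (psnd (psnd n)) = 1)) :: nat"
  show "recursive 2 (\<lambda>xs. of_bool (fm_ok L (xs ! 1) (xs ! 0)))"
  proof (rule recursive_course_of_values[where G = ?G])
    show "recursive 3 (\<lambda>xs. ?G (xs ! 0) (xs ! 1) (xs ! 2))"
      by (intro recursive_intros recursive_pred_mem recursive_terms_ok L) simp_all
    show "of_bool (fm_ok L x n) = ?G n (history (\<lambda>i. of_bool (fm_ok L x i)) n) x" for n x
    \<comment> \<open>Only positive tags look into the history, and there the arguments are below
      \<open>n\<close>.\<close>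
    proof (cases "pfst n = 0")
      case False
      then have "psnd n < n" "psnd (psnd n) < n" "pfst (psnd n) < n"
        using psnd_less[of n] psnd_le[of "psnd n"] pfst_le[of "psnd n"] by auto
      then show ?thesis by (simp add: fm_ok.simps[of L x n] del: history.simps)
    qed (simp add: fm_ok.simps[of L x n])
  qed
qed

section \<open>Exactness of the checkers\<close>

lemma terms_ok_iff:
  "terms_ok L x n \<longleftrightarrow> (\<exists>ts. n = list_encode (map code_tm ts) \<and>
     (\<forall>t\<in>set ts. wf_tm L t \<and> (\<forall>v\<in>vars_tm t. x \<noteq> Suc v)))"
    (is "_ \<longleftrightarrow> (\<exists>ts. _ = _ \<and> (\<forall>t\<in>set ts. ?ok t))")
proof (induction n rule: less_induct)
  case (less n)
  show ?case
  proof (cases n)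
    case 0
    then show ?thesis by (auto intro!: exI[of _ "[]"] simp: list_encode_eq[of _ "[]", simplified])
  next
    case (Suc m)
    \<comment> \<open>Every number decodes: \<open>a\<close> is the candidate head, with tag
      \<open>t\<close> and content \<open>c\<close>, and \<open>l\<close> the candidate tail. The
      content is a variable index for tag 0; for tag 1 it pairs a symbol \<open>f\<close> with the
      code \<open>l'\<close> of its arguments.\<close>
    obtain a l where m: "m = prod_encode (a, l)" by (metis prod_decode_inverse surj_pair)
    obtain t c where a: "a = prod_encode (t, c)" by (metis prod_decode_inverse surj_pair)
    obtain f l' where c: "c = prod_encode (f, l')" by (metis prod_decode_inverse surj_pair)
    have "l \<le> m" "l' \<le> c" "c \<le> a" "a \<le> m"
      unfolding m a c by (rule le_prod_encode_1 le_prod_encode_2)+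
    then have "l < n" "l' < n" using Suc by auto
    note IH = less.IH[OF \<open>l < n\<close>] less.IH[OF \<open>l' < n\<close>]
    have ok: "terms_ok L x n \<longleftrightarrow> terms_ok L x l \<and> (if t = 0 then x \<noteq> Suc c
        else t = 1 \<and> (f, length_code l') \<in> funs L \<and> terms_ok L x l')"
      unfolding Suc terms_ok.simps m a c by (simp add: inj_image_mem_iff inj_prod_encode)
    have head: "(if t = 0 then x \<noteq> Suc c
        else t = 1 \<and> (f, length_code l') \<in> funs L \<and> terms_ok L x l') \<longleftrightarrow> (\<exists>s. a = code_tm s \<and> ?ok s)"
      (is "?lhs \<longleftrightarrow> ?rhs")
    proof
      assume ?lhs
      show ?rhs
      proof (cases "t = 0")
        case True
        then show ?thesis using \<open>?lhs\<close> by (intro exI[of _ "Var c"]) (simp add: a)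
      next
        case False
        then obtain us where "l' = list_encode (map code_tm us)" "\<forall>u\<in>set us. ?ok u"
          using \<open>?lhs\<close> IH(2) by auto
        then show ?thesis using False \<open>?lhs\<close> by (intro exI[of _ "Fun f us"]) (auto simp: a c)
      qed
    next
      assume ?rhs
      then obtain s where s: "a = code_tm s" "?ok s" by blast
      show ?lhs
      proof (cases s)
        case (Var v)
        then show ?thesis using s by (simp add: a)
      next
        case (Fun g us)
        then have "t = 1" "f = g" "l' = list_encode (map code_tm us)"
          using s(1) by (auto simp: a c)
        then show ?thesis using s(2) Fun IH(2) by auto
      qed
    qed
    \<comment> \<open>As \<open>n\<close> is a successor, only nonempty lists can have it as
      code.\<close>
    have ex_Cons: "(\<exists>ts. Q ts) \<longleftrightarrow> (\<exists>s ts. Q (s # ts))" if "\<not> Q []" for Q :: "tm list \<Rightarrow> bool"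
      by (metis that list.exhaust)
    have "(\<exists>ts. n = list_encode (map code_tm ts) \<and> (\<forall>t\<in>set ts. ?ok t)) \<longleftrightarrow>
        (\<exists>s ts. n = list_encode (map code_tm (s # ts)) \<and> (\<forall>t\<in>set (s # ts). ?ok t))"
      by (rule ex_Cons) (simp add: Suc)
    also have "\<dots> \<longleftrightarrow> (\<exists>s. a = code_tm s \<and> ?ok s) \<and> terms_ok L x l"
      unfolding IH(1) by (auto simp: Suc m)
    finally show ?thesis unfolding ok head by (rule trans[OF conj_commute sym])
  qed
qed

lemma terms_ok_code:
  "terms_ok L x (list_encode (map code_tm ts)) \<longleftrightarrow>
     (\<forall>t\<in>set ts. wf_tm L t \<and> (\<forall>v\<in>vars_tm t. x \<noteq> Suc v))"
proof -
  have "inj code_tm" by (auto intro: injI code_tm_inject)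
  then show ?thesis unfolding terms_ok_iff by (auto simp: list_encode_eq inj_map_eq_map)
qed

text \<open>Well-formedness is assumed because \<open>fm_ok\<close> accepts a quantifier over the
  tested variable without looking at its body.\<close>

lemma fm_ok_code: "wf_fm L A \<Longrightarrow> fm_ok L x (code_fm A) \<longleftrightarrow> (\<forall>v\<in>free_vars A. x \<noteq> Suc v)"
proof (induction A)
  case (Eq s t)
  then show ?case
    using terms_ok_code[of L x "[s, t]"] by (subst fm_ok.simps) (auto simp del: list_encode.simps)
next
  case (Rel p ts)
  then show ?case
    by (subst fm_ok.simps) (auto simp: terms_ok_code inj_image_mem_iff inj_prod_encode)
qed (subst fm_ok.simps; auto)+

text \<open>The parameter \<open>0\<close> differs from every \<open>Suc v\<close>, so that shortcut
  at quantifiers never fires and the whole code is inspected.\<close>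

lemma fm_ok_0D: "fm_ok L 0 n \<Longrightarrow> \<exists>A. n = code_fm A \<and> wf_fm L A"
proof (induction n rule: less_induct)
  case (less n)
  obtain t c where n: "n = prod_encode (t, c)" by (metis prod_decode_inverse surj_pair)
  obtain a b where c: "c = prod_encode (a, b)" by (metis prod_decode_inverse surj_pair)
  have less_n: "c < n \<and> a < n \<and> b < n" if "t \<noteq> 0"
    using that psnd_less[of n] le_prod_encode_1[of a b] le_prod_encode_2[of b a]
    by (auto simp: n c)
  have ok: "if t = 0 then terms_ok L 0 (list_encode [a, b])
      else if t = 1 then (a, length_code b) \<in> rels L \<and> terms_ok L 0 b
      else if t = 2 then fm_ok L 0 c
      else if t = 3 then fm_ok L 0 a \<and> fm_ok L 0 b
      else t = 4 \<and> fm_ok L 0 b"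
    using less.prems
    by (subst (asm) fm_ok.simps) (simp add: n c inj_image_mem_iff inj_prod_encode
        del: list_encode.simps split: if_splits)
  consider "t = 0" | "t = 1" | "t = 2" | "t = 3" | "t = 4"
    using ok by (cases "t = 0"; cases "t = 1"; cases "t = 2"; cases "t = 3"; simp)
  then show ?case
  proof cases
    case 1
    then obtain s u where "a = code_tm s" "b = code_tm u" "wf_tm L s" "wf_tm L u"
      using ok by (auto simp: terms_ok_iff list_encode_eq Cons_eq_map_conv simp del: list_encode.simps)
    then show ?thesis using 1 by (intro exI[of _ "Eq s u"]) (simp add: n c)
  next
    case 2
    then obtain ts where "b = list_encode (map code_tm ts)" "\<forall>t\<in>set ts. wf_tm L t"
      using ok by (auto simp: terms_ok_iff)
    then show ?thesis using ok 2 by (intro exI[of _ "Rel a ts"]) (simp add: n c)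
  next
    case 3
    then obtain A where "c = code_fm A" "wf_fm L A" using ok less.IH[of c] less_n by auto
    then show ?thesis using 3 by (intro exI[of _ "Neg A"]) (simp add: n)
  next
    case 4
    then obtain A B where "a = code_fm A" "wf_fm L A" "b = code_fm B" "wf_fm L B"
      using ok less.IH[of a] less.IH[of b] less_n by auto
    then show ?thesis using 4 by (intro exI[of _ "Imp A B"]) (simp add: n c)
  next
    case 5
    then obtain A where "b = code_fm A" "wf_fm L A" using ok less.IH[of b] less_n by auto
    then show ?thesis using 5 by (intro exI[of _ "All a A"]) (simp add: n c)
  qed
qed

section \<open>Bounding the free variables by the code\<close>

lemma le_list_encode: "x \<in> set xs \<Longrightarrow> x \<le> list_encode xs"
proof (induction xs)
  case (Cons y ys)
  then show ?case
    using le_prod_encode_1[of y "list_encode ys"] le_prod_encode_2[of "list_encode ys" y] by auto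
qed simp

lemma vars_le_code_tm: "v \<in> vars_tm t \<Longrightarrow> v \<le> code_tm t"
proof (induction t rule: code_tm.induct)
  case (1 x)
  then show ?case using le_prod_encode_2[of x 0] by simp
next
  case (2 f ts)
  then obtain t where "t \<in> set ts" "v \<le> code_tm t" by auto
  then have "v \<le> list_encode (map code_tm ts)"
    using le_list_encode[of "code_tm t" "map code_tm ts"] by simp
  then show ?case by (auto intro: order_trans[OF _ le_prod_encode_2] simp del: One_nat_def)
qed

lemma free_vars_le_code_fm: "v \<in> free_vars A \<Longrightarrow> v \<le> code_fm A"
proof (induction A)
  case (Rel p ts)
  then obtain t where "t \<in> set ts" "v \<le> code_tm t" using vars_le_code_tm by auto
  then have "v \<le> list_encode (map code_tm ts)"
    using le_list_encode[of "code_tm t" "map code_tm ts"] by simp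
  then show ?case by (auto intro: order_trans[OF _ le_prod_encode_2])
next
  case (Eq s t)
  then show ?case
    by (auto dest!: vars_le_code_tm intro: order_trans[OF _ le_prod_encode_2] order_trans[OF _ le_prod_encode_1])
qed (auto intro: order_trans[OF _ le_prod_encode_2] order_trans[OF _ le_prod_encode_1])

text \<open>The value \<open>0\<close> checks well-formedness, and \<open>Suc v\<close> that
  \<open>v\<close> is not free. By \<open>free_vars_le_code_fm\<close> it is enough to test
  \<open>v \<le> n\<close>, hence the bound \<open>Suc n\<close>.\<close>

lemma sentence_code_iff: "n \<in> code_fm ` sentences L \<longleftrightarrow> (\<forall>x\<le>Suc n. fm_ok L x n)"
proof
  assume "n \<in> code_fm ` sentences L"
  then show "\<forall>x\<le>Suc n. fm_ok L x n" by (auto simp: sentences_def fm_ok_code)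
next
  assume ok: "\<forall>x\<le>Suc n. fm_ok L x n"
  then obtain A where A: "n = code_fm A" "wf_fm L A" using fm_ok_0D by blast
  have "v \<notin> free_vars A" for v
    using ok A fm_ok_code[OF A(2), of "Suc v"] free_vars_le_code_fm[of v A] by auto
  then show "n \<in> code_fm ` sentences L" using A by (auto simp: sentences_def)
qed

lemma recursive_sentence_code:
  assumes "effective_language L" "recursive k f"
  shows "recursive_pred k (\<lambda>xs. f xs \<in> code_fm ` sentences L)"
  unfolding sentence_code_iff
proof (rule recursive_compose2[of "\<lambda>m n. of_bool (\<forall>x\<le>m. fm_ok L x n)" k "\<lambda>xs. Suc (f xs)"])
  show "recursive 2 (\<lambda>xs. of_bool (\<forall>x\<le>xs ! 0. fm_ok L x (xs ! 1)))"
    by (rule recursive_pred_all_le, rule recursive_fm_ok[OF assms(1)]; intro recursive_intros; simp)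
qed (intro recursive_intros assms)+

section \<open>Reduction of \<open>T\<close> with \<open>Neg \<phi>\<close> to the given
  procedure\<close>

theorem theorem2:
  fixes L :: language and T :: "fm set" and \<phi> :: fm
  assumes "effective_language L"
    and "is_theory L T"
    and "\<phi> \<in> sentences L"
    and "\<not> decidable_theory L (add_axiom T (Neg \<phi>))"
  shows "\<not> (\<exists>r. decides_provability_from_proofs L (add_axiom T \<phi>) T r)"
proof
  assume "\<exists>r. decides_provability_from_proofs L (add_axiom T \<phi>) T r"
  then obtain r where r: "\<And>P A. is_proof_of L (insert \<phi> T) P A \<Longrightarrow> A \<in> sentences L
      \<Longrightarrow> evals r [code_proof P] (of_bool (provable L T A))"
    unfolding decides_provability_from_proofs_def add_axiom_def of_bool_def by blast
  let ?S = "code_fm ` sentences L"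
  let ?prf = "\<lambda>\<psi>. [\<phi>, Imp \<phi> (Imp (Neg \<psi>) \<phi>), Imp (Neg \<psi>) \<phi>]"
  \<comment> \<open>The tags 3 and 2 are those of \<open>Imp\<close> and \<open>Neg\<close> in
    \<open>code_fm\<close>; \<open>prf_code\<close> sends the code of \<open>\<psi>\<close> to that
    of \<open>?prf \<psi>\<close>.\<close>
  define imp where "imp a b = prod_encode (3, prod_encode (a, b))" for a b
  define prf_code where "prf_code a = list_encode [code_fm \<phi>,
      imp (code_fm \<phi>) (imp (prod_encode (2, a)) (code_fm \<phi>)), imp (prod_encode (2, a)) (code_fm \<phi>)]" for a
  \<comment> \<open>Numbers that code no sentence are sent to \<open>\<phi>\<close>, so that
    \<open>r\<close> only receives proofs of sentences; on other inputs it might diverge.\<close>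
  define fm_of where "fm_of n = (if n \<in> ?S then inv_into (sentences L) code_fm n else \<phi>)" for n
  have sentence: "fm_of n \<in> sentences L" for n
    using assms(3) by (auto simp: fm_of_def intro: inv_into_into)
  have code_fm_of: "code_fm (fm_of n) = (if n \<in> ?S then n else code_fm \<phi>)" for n
    by (auto simp: fm_of_def f_inv_into_f)
  have fm_of_code: "fm_of (code_fm \<psi>) = \<psi>" if "\<psi> \<in> sentences L" for \<psi>
    using that code_fm_of[of "code_fm \<psi>"] by (auto intro: code_fm_inject)
  have "recursive 1 (\<lambda>xs. prf_code (if xs ! 0 \<in> ?S then xs ! 0 else code_fm \<phi>))"
    unfolding prf_code_def imp_def list_encode.simps
    by (intro recursive_intros recursive_sentence_code assms(1)) simp_all
  then obtain s where "\<And>n. evals s [n] (prf_code (if n \<in> ?S then n else code_fm \<phi>))"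
    unfolding recursive_1_iff[of "\<lambda>n. prf_code (if n \<in> ?S then n else code_fm \<phi>)"] by blast
  then have "evals s [n] (code_proof (?prf (fm_of n)))" for n
    by (simp add: code_proof_def prf_code_def imp_def flip: code_fm_of)
  \<comment> \<open>The middle line of \<open>?prf\<close> is an instance of \<open>ax_K\<close> and
    the last follows by modus ponens, so \<open>r\<close> must answer.\<close>
  moreover have "evals r [code_proof (?prf (fm_of n))] (of_bool (provable L T (Imp (Neg (fm_of n)) \<phi>)))" for n
  proof (rule r)
    show "Imp (Neg (fm_of n)) \<phi> \<in> sentences L"
      using sentence[of n] assms(3) by (auto simp: sentences_def)
    have "wf_fm L (fm_of n)" "wf_fm L \<phi>"
      using sentence[of n] assms(3) by (auto simp: sentences_def)
    then show "is_proof_of L (insert \<phi> T) (?prf (fm_of n)) (Imp (Neg (fm_of n)) \<phi>)"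
      using is_proof_snoc[of L "insert \<phi> T" "[]"] is_proof_snoc[of L "insert \<phi> T" "[\<phi>]"]
        is_proof_snoc[of L "insert \<phi> T" "[\<phi>, _]"]
      by (auto simp: is_proof_of_def intro: ax_K)
  qed
  ultimately have "evals (Comp r [s]) [n] (of_bool (provable L T (Imp (Neg (fm_of n)) \<phi>)))" for n
    by (intro evals_Comp[where ys = "[code_proof (?prf (fm_of n))]"]) simp_all
  then have "recursive_pred 1 (\<lambda>xs. provable L T (Imp (Neg (fm_of (xs ! 0))) \<phi>))"
    unfolding recursive_1_iff[of "\<lambda>n. of_bool (provable L T (Imp (Neg (fm_of n)) \<phi>))"] by blast
  \<comment> \<open>The added conjunct discards the answers obtained from the default value of
    \<open>fm_of\<close>.\<close>
  then have "recursive_pred 1 (\<lambda>xs. xs ! 0 \<in> ?S \<and> provable L T (Imp (Neg (fm_of (xs ! 0))) \<phi>))"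
    by (intro recursive_intros recursive_sentence_code assms(1)) simp_all
  \<comment> \<open>On codes of sentences \<open>fm_of\<close> inverts the coding, and
    \<open>provable_add_Neg_iff\<close> applies.\<close>
  moreover have "n \<in> ?S \<and> provable L T (Imp (Neg (fm_of n)) \<phi>) \<longleftrightarrow>
      n \<in> code_fm ` theorems L (add_axiom T (Neg \<phi>))" for n
    by (auto simp: theorems_def add_axiom_def provable_add_Neg_iff[OF assms(3)] fm_of_code)
  ultimately have "recursive_pred 1 (\<lambda>xs. xs ! 0 \<in> code_fm ` theorems L (add_axiom T (Neg \<phi>)))"
    by simp
  then have "decidable_theory L (add_axiom T (Neg \<phi>))"
    unfolding decidable_theory_def decidable_iff_recursive_pred .
  then show False using assms(4) by contradiction
qed

end
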